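(* Let $\ell$ be a positive integer such that there exists an affine plane of order $\ell-2$. Then there exists an $(\ell(\ell-2)^2, (\ell-1)(\ell-2), \ell-2)$-BIBD admitting a $0$-ULSE $\ell$-colouring.
   Context: An affine plane of order $n$ is an $(n^2,n,1)$-BIBD. For positive integers $v,k,\lambda$ with $2\le k<v$, a $(v,k,\lambda)$-BIBD is a pair $(V,\mathcal{B})$ where $V$ is a set of $v$ points and $\mathcal{B}$ is a collection of $k$-element subsets of $V$ (blocks) such that every pair of distinct points lies in exactly $\lambda$ blocks. An $\ell$-colouring of a BIBD is a surjective map from $V$ onto a set of $\ell$ colours. A $0$-ULSE $\ell$-colouring is an $\ell$-colouring such that $(\ell-1)$ divides $k$ and in every block exactly one colour does not appear, while each of the other $\ell-1$ colours appears exactly $\frac{k}{\ell-1}$ times in that block. *)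

theory Defs
  imports Main "HOL-Library.Multiset"
begin

text \<open>The block collection is a multiset: repeated blocks are allowed, as usual in design theory,
  and the blocks through a pair of points are counted with multiplicity.\<close>

definition bibd :: "nat \<Rightarrow> nat \<Rightarrow> nat \<Rightarrow> 'a set \<Rightarrow> 'a set multiset \<Rightarrow> bool" where
  "bibd v k \<mu> V \<B> \<longleftrightarrow>
     2 \<le> k \<and> k < v \<and> 0 < \<mu> \<and>
     finite V \<and> card V = v \<and>
     (\<forall>B \<in># \<B>. B \<subseteq> V \<and> card B = k) \<and>
     (\<forall>x \<in> V. \<forall>y \<in> V. x \<noteq> y \<longrightarrow> size {#B \<in># \<B>. x \<in> B \<and> y \<in> B#} = \<mu>)"

definition affine_plane :: "nat \<Rightarrow> 'a set \<Rightarrow> 'a set multiset \<Rightarrow> bool" where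
  "affine_plane n V \<B> \<longleftrightarrow> bibd (n\<^sup>2) n 1 V \<B>"

definition colouring :: "nat \<Rightarrow> 'a set \<Rightarrow> 'c set \<Rightarrow> ('a \<Rightarrow> 'c) \<Rightarrow> bool" where
  "colouring l V C f \<longleftrightarrow> finite C \<and> card C = l \<and> f ` V = C"

definition zero_ULSE_colouring ::
  "nat \<Rightarrow> nat \<Rightarrow> 'a set \<Rightarrow> 'a set multiset \<Rightarrow> 'c set \<Rightarrow> ('a \<Rightarrow> 'c) \<Rightarrow> bool" where
  "zero_ULSE_colouring l k V \<B> C f \<longleftrightarrow>
     colouring l V C f \<and> (l - 1) dvd k \<and>
     (\<forall>B \<in># \<B>. \<exists>!c. c \<in> C \<and> c \<notin> f ` B) \<and>
     (\<forall>B \<in># \<B>. \<forall>c \<in> C. c \<in> f ` B \<longrightarrow> card {x \<in> B. f x = c} = k div (l - 1))"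

end

theory Submission
  imports Defs
begin

text \<open>Put \<open>n = l - 2\<close>. An affine plane of order \<open>n\<close> has \<open>n + 1\<close> parallel classes. Let \<open>M\<^sub>i\<close>
  be the \<open>n\<^sup>2 \<times> n\<^sup>2\<close> matrix whose \<open>(x, y)\<close> entry is 1 iff \<open>x\<close> and \<open>y\<close> lie on a common line of
  class \<open>i\<close>, and let \<open>M\<^bsub>n+1\<^esub> = 0\<close>. Then \<open>M\<^sub>i\<^sup>2 = n M\<^sub>i\<close>, \<open>M\<^sub>i M\<^sub>j = J\<close> for distinct
  \<open>i, j \<le> n\<close>, and the sum of all \<open>M\<^sub>i\<close> is \<open>n I + J\<close>. Substituting the \<open>M\<^sub>i\<close> for the symbols of a Latin
  square of order \<open>n + 2\<close> gives a matrix \<open>N\<close> whose product with its transpose is \<open>n\<^sup>2 I + n J\<close>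
  (Wallis' construction), that is, a symmetric design. The colour of a point is its row in the
  Latin square: each block has \<open>n\<close> points in every row except the one in which the symbol is
  \<open>n + 1\<close>.\<close>

section \<open>Parallel classes of an affine plane\<close>

locale plane =
  fixes n :: nat and P :: "'a set" and \<L> :: "'a set multiset"
  assumes plane: "affine_plane n P \<L>"
begin

lemma order_ge_2: "2 \<le> n"
  and finite_points: "finite P"
  and card_points: "card P = n\<^sup>2"
  and line_subset: "B \<in># \<L> \<Longrightarrow> B \<subseteq> P"
  and card_line: "B \<in># \<L> \<Longrightarrow> card B = n"
  using plane unfolding affine_plane_def bibd_def by auto

lemma joining_line:
  assumes "x \<in> P" "y \<in> P" "x \<noteq> y"
  shows "\<exists>!B. B \<in># \<L> \<and> x \<in> B \<and> y \<in> B"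
proof -
  have "size {#B \<in># \<L>. x \<in> B \<and> y \<in> B#} = 1"
    using plane assms unfolding affine_plane_def bibd_def by auto
  then obtain A where "{#B \<in># \<L>. x \<in> B \<and> y \<in> B#} = {#A#}"
    by (meson size_1_singleton_mset)
  then have "set_mset {#B \<in># \<L>. x \<in> B \<and> y \<in> B#} = {A}" by simp
  then have "B \<in># \<L> \<and> x \<in> B \<and> y \<in> B \<longleftrightarrow> B = A" for B
    by (auto simp: set_eq_iff)
  then show ?thesis by simp
qed

lemma lines_eq:
  assumes "A \<in># \<L>" "B \<in># \<L>" "x \<in> A" "x \<in> B" "y \<in> A" "y \<in> B" "x \<noteq> y"
  shows "A = B"
proof -
  have "x \<in> P" "y \<in> P" using assms line_subset[of A] by auto
  from joining_line[OF this assms(7)] assms(1-6) show ?thesis by (metis (no_types, lifting))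
qed

section \<open>Lines through a point\<close>

definition pencil :: "'a \<Rightarrow> 'a set set" where
  "pencil x = {B. B \<in># \<L> \<and> x \<in> B}"

lemma finite_pencil: "finite (pencil x)"
  by (rule finite_subset[of _ "set_mset \<L>"]) (auto simp: pencil_def)

text \<open>The lines through \<open>x\<close> partition the other n^2 - 1 = (n + 1)(n - 1) points
  into sets of size n - 1, and n - 1 > 0 can be cancelled.\<close>

lemma card_pencil:
  assumes "x \<in> P"
  shows "card (pencil x) = n + 1"
proof -
  have "P - {x} = (\<Union>B\<in>pencil x. B - {x})"
  proof (intro equalityI subsetI)
    fix y assume "y \<in> P - {x}"
    then obtain B where "B \<in># \<L>" "x \<in> B" "y \<in> B"
      using joining_line[OF assms, of y] by (auto elim: ex1E)
    then show "y \<in> (\<Union>B\<in>pencil x. B - {x})"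
      using \<open>y \<in> P - {x}\<close> by (auto simp: pencil_def)
  next
    fix y assume "y \<in> (\<Union>B\<in>pencil x. B - {x})"
    then show "y \<in> P - {x}" using line_subset by (auto simp: pencil_def)
  qed
  then have "card (P - {x}) = card (\<Union>B\<in>pencil x. B - {x})" by simp
  also have "\<dots> = (\<Sum>B\<in>pencil x. card (B - {x}))"
  proof (rule card_UN_disjoint[OF finite_pencil])
    show "\<forall>B\<in>pencil x. finite (B - {x})"
      using finite_points line_subset by (auto simp: pencil_def intro: finite_subset)
    show "\<forall>A\<in>pencil x. \<forall>B\<in>pencil x. A \<noteq> B \<longrightarrow> (A - {x}) \<inter> (B - {x}) = {}"
      using lines_eq by (auto simp: pencil_def)
  qed
  also have "\<dots> = (\<Sum>B\<in>pencil x. n - 1)"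
    by (rule sum.cong) (auto simp: pencil_def card_line)
  also have "\<dots> = card (pencil x) * (n - 1)" by simp
  finally have "n\<^sup>2 - 1 = card (pencil x) * (n - 1)"
    using assms card_points finite_points by simp
  moreover have "n\<^sup>2 - 1 = (n + 1) * (n - 1)"
    by (simp add: power2_eq_square algebra_simps)
  ultimately show ?thesis using order_ge_2
    by (metis One_nat_def diff_is_0_eq mult_cancel2 not_less_eq_eq numeral_2_eq_2)
qed

section \<open>Parallelism of lines\<close>

definition parallel :: "'a set \<Rightarrow> 'a set \<Rightarrow> bool" where
  "parallel A B \<longleftrightarrow> A = B \<or> A \<inter> B = {}"

text \<open>For \<open>x\<close> off \<open>A\<close>, joining \<open>x\<close> to the n points of
  \<open>A\<close> uses n of the n + 1 lines through \<open>x\<close>; the single line left over is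
  the one missing \<open>A\<close>.\<close>

lemma playfair:
  assumes "x \<in> P" "A \<in># \<L>"
  shows "\<exists>!B. B \<in># \<L> \<and> x \<in> B \<and> parallel B A"
proof (cases "x \<in> A")
  case True
  then show ?thesis using assms unfolding parallel_def by blast
next
  case False
  have "\<exists>B. B \<in># \<L> \<and> x \<in> B \<and> y \<in> B" if "y \<in> A" for y
    using joining_line[OF assms(1), of y] False that line_subset[OF assms(2)] by blast
  then obtain j where j: "\<And>y. y \<in> A \<Longrightarrow> j y \<in># \<L> \<and> x \<in> j y \<and> y \<in> j y"
    by metis
  \<comment> \<open>A line through \<open>x\<close> with two points on \<open>A\<close> would equal
    \<open>A\<close>, which avoids \<open>x\<close>.\<close>
  have "inj_on j A"
  proof (rule inj_onI)
    fix y z assume "y \<in> A" "z \<in> A" "j y = j z"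
    then show "y = z"
      using lines_eq[OF assms(2), of "j y" y z] j[of y] j[of z] False by auto
  qed
  then have "card (j ` A) = n"
    using card_line[OF assms(2)] by (simp add: card_image)
  moreover have meet: "j ` A = {B \<in> pencil x. B \<inter> A \<noteq> {}}"
  proof
    show "j ` A \<subseteq> {B \<in> pencil x. B \<inter> A \<noteq> {}}"
      using j by (auto simp: pencil_def)
    show "{B \<in> pencil x. B \<inter> A \<noteq> {}} \<subseteq> j ` A"
    proof
      fix B assume "B \<in> {B \<in> pencil x. B \<inter> A \<noteq> {}}"
      then obtain y where y: "B \<in># \<L>" "x \<in> B" "y \<in> B" "y \<in> A"
        by (auto simp: pencil_def)
      then have "B = j y" using lines_eq[of B "j y" x y] j[of y] False by auto
      then show "B \<in> j ` A" using y by blast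
    qed
  qed
  ultimately have "card (pencil x - j ` A) = 1"
    using card_pencil[OF assms(1)] finite_pencil[of x]
    by (subst card_Diff_subset) (auto intro: finite_subset)
  then obtain B where "pencil x - j ` A = {B}"
    by (meson card_1_singletonE)
  then have "C \<in># \<L> \<and> x \<in> C \<and> C \<inter> A = {} \<longleftrightarrow> C = B" for C
    unfolding meet by (auto simp: pencil_def set_eq_iff[of _ "{B}"])
  moreover have "x \<in> C \<Longrightarrow> parallel C A \<longleftrightarrow> C \<inter> A = {}" for C
    using False by (auto simp: parallel_def)
  ultimately have "C \<in># \<L> \<and> x \<in> C \<and> parallel C A \<longleftrightarrow> C = B" for C
    by metis
  then show ?thesis by simp
qed

lemma parallel_sym: "parallel A B \<Longrightarrow> parallel B A"
  unfolding parallel_def by blast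

text \<open>If \<open>A\<close> and \<open>C\<close> share a point, both are the parallel to
  \<open>B\<close> through it, so they coincide by \<open>playfair\<close>.\<close>

lemma parallel_trans:
  assumes "A \<in># \<L>" "B \<in># \<L>" "C \<in># \<L>" "parallel A B" "parallel B C"
  shows "parallel A C"
proof (rule ccontr)
  assume np: "\<not> parallel A C"
  then obtain x where x: "x \<in> A" "x \<in> C" unfolding parallel_def by blast
  then have "x \<in> P" using line_subset assms by blast
  then have "A = C"
    using playfair[of x B] assms x parallel_sym by blast
  then show False using np unfolding parallel_def by blast
qed

text \<open>A parallel class is represented by one of its lines \<open>A\<close>;
  \<open>playfair\<close> makes the description well defined.\<close>

definition parallel_through :: "'a set \<Rightarrow> 'a \<Rightarrow> 'a set" where
  "parallel_through A x = (THE B. B \<in># \<L> \<and> x \<in> B \<and> parallel B A)"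

lemma parallel_through:
  assumes "A \<in># \<L>" "x \<in> P"
  shows "parallel_through A x \<in># \<L>" "x \<in> parallel_through A x"
    "parallel (parallel_through A x) A"
  using theI'[OF playfair[OF assms(2,1)]] unfolding parallel_through_def by auto

lemma parallel_through_eqI:
  assumes "A \<in># \<L>" "x \<in> P" "B \<in># \<L>" "x \<in> B" "parallel B A"
  shows "parallel_through A x = B"
  using the1_equality[OF playfair[OF assms(2,1)]] assms(3-5) unfolding parallel_through_def by simp

lemma mem_parallel_through_iff:
  assumes "A \<in># \<L>" "x \<in> P" "y \<in> P"
  shows "y \<in> parallel_through A x \<longleftrightarrow> parallel_through A y = parallel_through A x"
proof
  assume "y \<in> parallel_through A x"
  then show "parallel_through A y = parallel_through A x"
    using parallel_through[OF assms(1,2)] by (intro parallel_through_eqI assms)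
next
  assume "parallel_through A y = parallel_through A x"
  then show "y \<in> parallel_through A x"
    using parallel_through(2)[OF assms(1,3)] by simp
qed

text \<open>The lines through a fixed \<open>p\<close> represent the parallel classes. Such an
  \<open>A\<close> satisfies the equation exactly when it is parallel to the line joining
  \<open>x\<close> and \<open>y\<close>, and \<open>playfair\<close> at \<open>p\<close> gives one
  such line.\<close>

lemma unique_direction:
  assumes "p \<in> P" "x \<in> P" "y \<in> P" "x \<noteq> y"
  shows "\<exists>!A. A \<in> pencil p \<and> parallel_through A x = parallel_through A y"
proof -
  obtain B where B: "B \<in># \<L>" "x \<in> B" "y \<in> B"
    using joining_line[OF assms(2-4)] by blast
  have "parallel_through A x = parallel_through A y \<longleftrightarrow> parallel A B" if "A \<in># \<L>" for A
  proof
    assume "parallel_through A x = parallel_through A y"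
    then have "y \<in> parallel_through A x"
      using parallel_through that assms by auto
    then have "B = parallel_through A x"
      using B lines_eq[of B "parallel_through A x" x y] parallel_through[OF that assms(2)] assms(4)
      by blast
    then show "parallel A B" using parallel_through(3)[OF that assms(2)] parallel_sym by blast
  next
    assume "parallel A B"
    then show "parallel_through A x = parallel_through A y"
      using parallel_through_eqI[OF that _ B(1)] B assms parallel_sym by metis
  qed
  then have "A \<in> pencil p \<and> parallel_through A x = parallel_through A y
      \<longleftrightarrow> A \<in># \<L> \<and> p \<in> A \<and> parallel A B" for A
    by (auto simp: pencil_def)
  then show ?thesis using playfair[OF assms(1) B(1)] by simp
qed

text \<open>\<open>A\<close> and \<open>B\<close> share \<open>p\<close> but differ, so they are not
  parallel. By transitivity neither are the two translates, which therefore share exactly one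
  point.\<close>

lemma distinct_directions_meet:
  assumes "A \<in> pencil p" "B \<in> pencil p" "A \<noteq> B" "x \<in> P" "y \<in> P"
  shows "\<exists>z. parallel_through A x \<inter> parallel_through B y = {z}"
proof -
  let ?a = "parallel_through A x" and ?b = "parallel_through B y"
  have AB: "A \<in># \<L>" "B \<in># \<L>" using assms by (auto simp: pencil_def)
  note a = parallel_through[OF AB(1) assms(4)] and b = parallel_through[OF AB(2) assms(5)]
  have "\<not> parallel A B" using assms by (auto simp: pencil_def parallel_def)
  then have np: "\<not> parallel ?a ?b"
    using a b AB parallel_trans[of A ?a ?b] parallel_trans[of A ?b B] parallel_sym by blast
  then obtain z where z: "z \<in> ?a" "z \<in> ?b" unfolding parallel_def by blast
  have "w = z" if "w \<in> ?a" "w \<in> ?b" for w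
    using lines_eq[OF a(1) b(1) z that] np unfolding parallel_def by blast
  then show ?thesis using z by blast
qed

end

section \<open>The construction\<close>

text \<open>\<open>R i x\<close> is the line of class \<open>i\<close> through \<open>x\<close>, the
  support of a row of \<open>M_i\<close>. The classes are 0 to \<open>n\<close>, leaving n + 1 free
  as the symbol for the zero matrix. \<open>mem_line_iff\<close> with \<open>card_line\<close>
  encodes M_i^2 = n M_i, \<open>classes_meet\<close> encodes M_i M_j = J, and
  \<open>unique_class\<close> encodes the sum n I + J.\<close>

locale parallel_classes =
  fixes n :: nat and P :: "'a set" and R :: "nat \<Rightarrow> 'a \<Rightarrow> 'a set"
  assumes order_ge_2: "2 \<le> n"
    and finite_points: "finite P"
    and card_points: "card P = n\<^sup>2"
    and line_subset: "\<lbrakk>i \<le> n; x \<in> P\<rbrakk> \<Longrightarrow> R i x \<subseteq> P"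
    and card_line: "\<lbrakk>i \<le> n; x \<in> P\<rbrakk> \<Longrightarrow> card (R i x) = n"
    and mem_line_iff: "\<lbrakk>i \<le> n; x \<in> P; y \<in> P\<rbrakk> \<Longrightarrow> y \<in> R i x \<longleftrightarrow> R i y = R i x"
    and unique_class: "\<lbrakk>x \<in> P; y \<in> P; x \<noteq> y\<rbrakk> \<Longrightarrow> \<exists>!i. i \<le> n \<and> R i x = R i y"
    and classes_meet: "\<lbrakk>i \<le> n; j \<le> n; i \<noteq> j; x \<in> P; y \<in> P\<rbrakk> \<Longrightarrow> \<exists>z. R i x \<inter> R j y = {z}"

lemma affine_plane_parallel_classes:
  assumes "affine_plane n P \<L>"
  shows "\<exists>R. parallel_classes n P R"
proof -
  interpret plane n P \<L> by (rule plane.intro[OF assms])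
  have "P \<noteq> {}" using card_points order_ge_2 by auto
  then obtain p where p: "p \<in> P" by blast
  \<comment> \<open>Each parallel class has exactly one line through \<open>p\<close>, so numbering
    these n + 1 lines numbers the classes.\<close>
  have "card {..n} = card (pencil p)" using card_pencil[OF p] by simp
  then obtain h where h: "bij_betw h {..n} (pencil p)"
    using finite_same_card_bij[OF _ finite_pencil] by blast
  have hp: "h i \<in> pencil p" "h i \<in># \<L>" if "i \<le> n" for i
    using h that by (auto simp: bij_betw_def pencil_def)
  have "parallel_classes n P (\<lambda>i. parallel_through (h i))"
  proof
    fix x y assume xy: "x \<in> P" "y \<in> P" "x \<noteq> y"
    from unique_direction[OF p xy] obtain A
      where A: "A \<in> pencil p \<and> parallel_through A x = parallel_through A y"
        and uniq: "\<forall>B. B \<in> pencil p \<and> parallel_through B x = parallel_through B y \<longrightarrow> B = A"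
      by (rule ex1E)
    have "A \<in> h ` {..n}" using A h by (simp add: bij_betw_def)
    then obtain i where i: "i \<le> n" "h i = A" by auto
    show "\<exists>!i. i \<le> n \<and> parallel_through (h i) x = parallel_through (h i) y"
    proof (rule ex1I[of _ i])
      show "i \<le> n \<and> parallel_through (h i) x = parallel_through (h i) y"
        using i A by simp
      show "k = i" if "k \<le> n \<and> parallel_through (h k) x = parallel_through (h k) y" for k
      proof -
        have "h k = h i" using that i uniq hp by blast
        then show ?thesis using that i h by (auto simp: bij_betw_def inj_on_def)
      qed
    qed
  next
    fix i j x y assume "i \<le> n" "j \<le> n" "i \<noteq> j" "x \<in> P" "y \<in> P"
    moreover from this have "h i \<noteq> h j"
      using bij_betw_imp_inj_on[OF h] by (auto dest: inj_onD)
    ultimately show "\<exists>z. parallel_through (h i) x \<inter> parallel_through (h j) y = {z}"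
      by (intro distinct_directions_meet[of _ p] hp)
  next
    fix i x assume ix: "i \<le> n" "x \<in> P"
    note line = parallel_through[OF hp(2)[OF ix(1)] ix(2)]
    show "parallel_through (h i) x \<subseteq> P" "card (parallel_through (h i) x) = n"
      using line_subset[OF line(1)] card_line[OF line(1)] by auto
    fix y assume "y \<in> P"
    then show "y \<in> parallel_through (h i) x \<longleftrightarrow> parallel_through (h i) y = parallel_through (h i) x"
      by (rule mem_parallel_through_iff[OF hp(2)[OF ix(1)] ix(2)])
  qed (fact order_ge_2 finite_points card_points)+
  then show ?thesis by blast
qed

lemma add_mod_eq_ex1:
  fixes a s m :: nat
  assumes "a < m" "s < m"
  shows "\<exists>!b. b < m \<and> (a + b) mod m = s"
proof (rule ex1I[of _ "if a \<le> s then s - a else s + m - a"])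
  show "(if a \<le> s then s - a else s + m - a) < m \<and>
      (a + (if a \<le> s then s - a else s + m - a)) mod m = s"
    using assms by auto
next
  fix b assume b: "b < m \<and> (a + b) mod m = s"
  \<comment> \<open>Since a + b < 2m, reduction modulo \<open>m\<close> subtracts \<open>m\<close>
    at most once.\<close>
  then have "(if a + b < m then a + b else a + b - m) = s"
    using assms(1) by (auto simp: mod_if)
  then show "b = (if a \<le> s then s - a else s + m - a)"
    using assms b by (auto split: if_splits)
qed

context parallel_classes
begin

text \<open>Entry \<open>(a, b)\<close> of the Latin square of order \<open>n + 2\<close> given by the Cayley table of the cyclic
  group.\<close>

definition symbol :: "nat \<Rightarrow> nat \<Rightarrow> nat" where
  "symbol a b = (a + b) mod (n + 2)"

text \<open>The support of column \<open>(b, y)\<close> of N; rows \<open>a\<close> with symbol n +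
  1 contribute nothing.\<close>

definition block :: "nat \<times> 'a \<Rightarrow> (nat \<times> 'a) set" where
  "block = (\<lambda>(b, y). SIGMA a:{a. a < n + 2 \<and> symbol a b \<le> n}. R (symbol a b) y)"

definition points :: "(nat \<times> 'a) set" where
  "points = {..<n + 2} \<times> P"

text \<open>One block per column of N, so counting blocks through a pair is counting
  columns.\<close>

definition blocks :: "(nat \<times> 'a) set multiset" where
  "blocks = image_mset block (mset_set points)"

lemma symbol_less: "symbol a b < n + 2"
  by (simp add: symbol_def)

lemma symbol_commute: "symbol a b = symbol b a"
  by (simp add: symbol_def add.commute)

lemma symbol_ex1: "a < n + 2 \<Longrightarrow> s < n + 2 \<Longrightarrow> \<exists>!b. b < n + 2 \<and> symbol a b = s"
  unfolding symbol_def by (rule add_mod_eq_ex1)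

lemma symbol_inj:
  assumes "symbol a b = symbol c b" "a < n + 2" "b < n + 2" "c < n + 2"
  shows "a = c"
  using symbol_ex1[OF assms(3) symbol_less[of a b]] assms symbol_commute by metis

lemma finite_design_points: "finite points"
  by (simp add: points_def finite_points)

lemma mem_block: "(a, x) \<in> block (b, y) \<longleftrightarrow> a < n + 2 \<and> symbol a b \<le> n \<and> x \<in> R (symbol a b) y"
  by (simp add: block_def)

lemma block_subset: "u \<in> points \<Longrightarrow> block u \<subseteq> points"
  using line_subset by (fastforce simp: points_def block_def)

text \<open>The omitted row \<open>a0\<close> is the one place in column \<open>b\<close> where the
  symbol is n + 1; every other symbol is at most \<open>n\<close>.\<close>

lemma block_column:
  assumes "b < n + 2"
  obtains a0 where "a0 < n + 2" "{a. a < n + 2 \<and> symbol a b \<le> n} = {..<n + 2} - {a0}"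
proof -
  obtain a0 where a0: "a0 < n + 2" "symbol b a0 = n + 1"
    and u: "\<And>a. a < n + 2 \<Longrightarrow> symbol b a = n + 1 \<Longrightarrow> a = a0"
    using symbol_ex1[OF assms, of "n + 1"] by auto
  have "symbol a b \<le> n \<longleftrightarrow> a \<noteq> a0" if "a < n + 2" for a
    using u[OF that] a0 symbol_less[of a b] symbol_commute[of a b]
    by (cases "a = a0") (auto simp: less_Suc_eq_le le_Suc_eq)
  then show thesis using a0(1) by (intro that[of a0]) auto
qed

lemma card_block:
  assumes "u \<in> points"
  shows "card (block u) = (n + 1) * n"
proof -
  obtain b y where u: "u = (b, y)" "b < n + 2" "y \<in> P"
    using assms by (auto simp: points_def)
  obtain a0 where a0: "a0 < n + 2" "{a. a < n + 2 \<and> symbol a b \<le> n} = {..<n + 2} - {a0}"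
    using block_column[OF u(2)] .
  have "card (block u) = (\<Sum>a | a < n + 2 \<and> symbol a b \<le> n. card (R (symbol a b) y))"
    unfolding u block_def prod.case
    by (rule card_SigmaI) (use u line_subset finite_points in \<open>auto intro: finite_subset\<close>)
  also have "\<dots> = (\<Sum>a | a < n + 2 \<and> symbol a b \<le> n. n)"
    by (rule sum.cong) (use u card_line in auto)
  also have "\<dots> = (n + 1) * n" unfolding a0(2) using a0(1) by simp
  finally show ?thesis .
qed

section \<open>Counting the blocks through a pair of points\<close>

lemma line_sym:
  assumes "i \<le> n" "x \<in> P" "y \<in> P"
  shows "x \<in> R i y \<longleftrightarrow> y \<in> R i x"
  using mem_line_iff assms by metis

text \<open>A block \<open>(b, z)\<close> contains both points only if \<open>symbol a b\<close> is
  the class \<open>i\<close> of the line joining \<open>x\<close> and \<open>y\<close>. This fixes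
  \<open>b\<close>, and \<open>z\<close> then runs over the n points of that line.\<close>

lemma pair_count_same_row:
  assumes "a < n + 2" "x \<in> P" "y \<in> P" "x \<noteq> y"
  shows "card {u \<in> points. (a, x) \<in> block u \<and> (a, y) \<in> block u} = n"
proof -
  obtain i where i: "i \<le> n" "R i x = R i y" and ui: "\<And>j. j \<le> n \<Longrightarrow> R j x = R j y \<Longrightarrow> j = i"
    using unique_class[OF assms(2-4)] by blast
  obtain b where b: "b < n + 2" "symbol a b = i" and ub: "\<And>c. c < n + 2 \<Longrightarrow> symbol a c = i \<Longrightarrow> c = b"
    using symbol_ex1[OF assms(1), of i] i(1) by auto
  have "{u \<in> points. (a, x) \<in> block u \<and> (a, y) \<in> block u} = {b} \<times> R i x"
  proof (intro equalityI subsetI)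
    fix u assume "u \<in> {u \<in> points. (a, x) \<in> block u \<and> (a, y) \<in> block u}"
    then obtain c z where u: "u = (c, z)" "c < n + 2" "z \<in> P"
      and m: "symbol a c \<le> n" "x \<in> R (symbol a c) z" "y \<in> R (symbol a c) z"
      by (auto simp: points_def mem_block)
    have "R (symbol a c) x = R (symbol a c) y"
      using m u mem_line_iff assms by metis
    then have "symbol a c = i" using ui m by blast
    then show "u \<in> {b} \<times> R i x" using u m ub line_sym assms i by auto
  next
    fix u assume "u \<in> {b} \<times> R i x"
    then obtain z where u: "u = (b, z)" "z \<in> R i x" by blast
    then have "z \<in> P" using line_subset i assms by blast
    then show "u \<in> {u \<in> points. (a, x) \<in> block u \<and> (a, y) \<in> block u}"
      using u b i assms line_sym[of i x z] line_sym[of i y z] by (auto simp: points_def mem_block)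
  qed
  then show ?thesis using card_line[OF i(1) assms(2)] by (simp add: card_cartesian_product)
qed

text \<open>Rows \<open>a\<close> and \<open>c\<close> of the Latin square carry different symbols
  in every column. Both symbols are at most \<open>n\<close> in all but two columns, and in each of
  these n columns two lines of different classes meet in one \<open>z\<close>.\<close>

lemma pair_count_distinct_rows:
  assumes "a < n + 2" "c < n + 2" "a \<noteq> c" "x \<in> P" "y \<in> P"
  shows "card {u \<in> points. (a, x) \<in> block u \<and> (c, y) \<in> block u} = n"
proof -
  define G where "G = {b. b < n + 2 \<and> symbol b a \<le> n} \<inter> {b. b < n + 2 \<and> symbol b c \<le> n}"
  \<comment> \<open>The table is symmetric, so \<open>block_column\<close> applied to
    \<open>a\<close> and \<open>c\<close> describes rows: \<open>b1\<close> and \<open>b2\<close>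
    are the columns where they carry n + 1.\<close>
  obtain b1 where b1: "b1 < n + 2" "{b. b < n + 2 \<and> symbol b a \<le> n} = {..<n + 2} - {b1}"
    using block_column[OF assms(1)] .
  obtain b2 where b2: "b2 < n + 2" "{b. b < n + 2 \<and> symbol b c \<le> n} = {..<n + 2} - {b2}"
    using block_column[OF assms(2)] .
  have "b1 \<noteq> b2"
  proof
    assume "b1 = b2"
    have "\<not> symbol b1 a \<le> n" "\<not> symbol b1 c \<le> n"
      using b1 b2 \<open>b1 = b2\<close> by blast+
    then have "symbol a b1 = symbol c b1"
      using symbol_less[of b1 a] symbol_less[of b1 c] symbol_commute[of b1] by simp
    then show False using symbol_inj assms b1 by blast
  qed
  moreover have "G = {..<n + 2} - {b1, b2}" unfolding G_def b1 b2 by blast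
  ultimately have cG: "card G = n" using b1 b2 by (simp add: card_Diff_subset)
  have S: "{u \<in> points. (a, x) \<in> block u \<and> (c, y) \<in> block u}
      = (SIGMA b:G. R (symbol a b) x \<inter> R (symbol c b) y)" (is "?L = ?S")
  proof (intro equalityI subsetI)
    fix u assume "u \<in> ?L"
    then show "u \<in> ?S"
      using assms line_sym by (auto simp: points_def mem_block G_def symbol_commute)
  next
    fix u assume "u \<in> ?S"
    then obtain b z where u: "u = (b, z)" "b < n + 2" "symbol a b \<le> n" "symbol c b \<le> n"
      "z \<in> R (symbol a b) x" "z \<in> R (symbol c b) y"
      by (auto simp: G_def symbol_commute)
    then have "z \<in> P" using line_subset assms by blast
    then show "u \<in> ?L" using u assms line_sym by (auto simp: points_def mem_block)
  qed
  have one: "\<exists>z. R (symbol a b) x \<inter> R (symbol c b) y = {z}" if "b \<in> G" for b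
    using that assms symbol_inj by (intro classes_meet) (auto simp: G_def symbol_commute)
  have "card ?S = (\<Sum>b\<in>G. card (R (symbol a b) x \<inter> R (symbol c b) y))"
    by (rule card_SigmaI) (use one in \<open>force simp: G_def\<close>)+
  also have "\<dots> = (\<Sum>b\<in>G. 1)"
    by (rule sum.cong) (use one in force)+
  finally show ?thesis using S cG by simp
qed

lemma bibd_blocks: "bibd ((n + 2) * n\<^sup>2) ((n + 1) * n) n points blocks"
  unfolding bibd_def
proof (intro conjI ballI impI)
  have "1 * 2 \<le> (n + 1) * n" using order_ge_2 by (intro mult_le_mono) auto
  then show "2 \<le> (n + 1) * n" by simp
  have "(n + 1) * n < (n + 2) * n" using order_ge_2 by simp
  also have "\<dots> \<le> (n + 2) * n\<^sup>2" by (intro mult_le_mono) (auto simp: power2_eq_square)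
  finally show "(n + 1) * n < (n + 2) * n\<^sup>2" .
  show "0 < n" using order_ge_2 by simp
  show "finite points" by (rule finite_design_points)
  show "card points = (n + 2) * n\<^sup>2" by (simp add: points_def card_cartesian_product card_points)
next
  fix B assume "B \<in># blocks"
  then obtain u where "u \<in> points" "B = block u"
    using finite_design_points by (auto simp: blocks_def)
  then show "B \<subseteq> points" "card B = (n + 1) * n" using block_subset card_block by auto
next
  fix u w assume uw: "u \<in> points" "w \<in> points" "u \<noteq> w"
  \<comment> \<open>Multiplicities are counted through the indices \<open>t\<close> of the
    columns.\<close>
  have "size {#B \<in># blocks. u \<in> B \<and> w \<in> B#} = card {t \<in> points. u \<in> block t \<and> w \<in> block t}"
    by (simp add: blocks_def filter_mset_image_mset filter_mset_mset_set finite_design_points)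
  also have "\<dots> = n"
  proof (cases "fst u = fst w")
    case True
    then show ?thesis using uw pair_count_same_row[of "fst u" "snd u" "snd w"]
      by (cases u; cases w) (auto simp: points_def)
  next
    case False
    then show ?thesis using uw pair_count_distinct_rows[of "fst u" "fst w" "snd u" "snd w"]
      by (cases u; cases w) (auto simp: points_def)
  qed
  finally show "size {#B \<in># blocks. u \<in> B \<and> w \<in> B#} = n" .
qed

lemma zero_ULSE_colouring_fst:
  "zero_ULSE_colouring (n + 2) ((n + 1) * n) points blocks {..<n + 2} fst"
  unfolding zero_ULSE_colouring_def colouring_def
proof (intro conjI ballI impI)
  have "P \<noteq> {}" using card_points order_ge_2 by auto
  then show "fst ` points = {..<n + 2}" by (simp add: points_def)
next
  show "n + 2 - 1 dvd (n + 1) * n" by (rule dvdI[of _ _ n]) simp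
next
  fix B assume "B \<in># blocks"
  then obtain b y where B: "B = block (b, y)" "b < n + 2" "y \<in> P"
    using finite_design_points by (auto simp: blocks_def points_def)
  obtain a0 where a0: "a0 < n + 2" "{a. a < n + 2 \<and> symbol a b \<le> n} = {..<n + 2} - {a0}"
    using block_column[OF B(2)] .
  \<comment> \<open>Lines are nonempty, so every row with symbol at most \<open>n\<close> really
    occurs as a colour of the block.\<close>
  have ne: "R i y \<noteq> {}" if "i \<le> n" for i
    using card_line[OF that B(3)] order_ge_2 by auto
  have "fst ` B = {a. a < n + 2 \<and> symbol a b \<le> n}"
    using ne by (auto simp: B(1) block_def fst_image_Sigma)
  then have image: "fst ` B = {..<n + 2} - {a0}" using a0 by simp
  then show "\<exists>!c. c \<in> {..<n + 2} \<and> c \<notin> fst ` B" using a0 by auto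
  fix c assume "c \<in> fst ` B"
  then have c: "c < n + 2" "symbol c b \<le> n" by (auto simp: B(1) block_def)
  then have "{x \<in> B. fst x = c} = {c} \<times> R (symbol c b) y"
    by (auto simp: B(1) block_def)
  then show "card {x \<in> B. fst x = c} = (n + 1) * n div (n + 2 - 1)"
    using card_line[OF c(2) B(3)] by (simp add: card_cartesian_product del: mult_Suc)
qed auto

end

section \<open>Relabelling the points\<close>

text \<open>Used to move the design from \<open>nat \<times> 'a\<close> to points that are natural
  numbers.\<close>

lemma bibd_image:
  assumes "bibd v k \<mu> V \<B>" "inj_on g V"
  shows "bibd v k \<mu> (g ` V) (image_mset ((`) g) \<B>)"
proof -
  have sub: "B \<subseteq> V" if "B \<in># \<B>" for B
    using assms(1) that by (auto simp: bibd_def)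
  have "size {#B \<in># image_mset ((`) g) \<B>. g x \<in> B \<and> g y \<in> B#} = size {#B \<in># \<B>. x \<in> B \<and> y \<in> B#}"
    if "x \<in> V" "y \<in> V" for x y
  proof -
    have "{#B \<in># \<B>. g x \<in> g ` B \<and> g y \<in> g ` B#} = {#B \<in># \<B>. x \<in> B \<and> y \<in> B#}"
      by (rule filter_mset_cong)
        (use sub that inj_on_image_mem_iff[OF assms(2)] in auto)
    then show ?thesis by (simp add: filter_mset_image_mset)
  qed
  moreover have "card (g ` B) = card B" if "B \<in># \<B>" for B
    using sub[OF that] assms(2) by (meson card_image inj_on_subset)
  ultimately show ?thesis
    using assms sub unfolding bibd_def by (auto simp: card_image image_mono)
qed

lemma zero_ULSE_colouring_image:
  assumes "zero_ULSE_colouring l k V \<B> C f" "inj_on g V" "\<And>B. B \<in># \<B> \<Longrightarrow> B \<subseteq> V"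
  shows "zero_ULSE_colouring l k (g ` V) (image_mset ((`) g) \<B>) C (f \<circ> inv_into V g)"
proof -
  let ?f = "f \<circ> inv_into V g"
  have im: "?f ` g ` B = f ` B" if "B \<subseteq> V" for B
    using that assms(2) by (force simp: image_image intro!: image_cong)
  have "card {x \<in> g ` B. ?f x = c} = card {x \<in> B. f x = c}" if "B \<subseteq> V" for B c
  proof -
    have "{x \<in> g ` B. ?f x = c} = g ` {x \<in> B. f x = c}"
      using that assms(2) by (auto simp: subset_iff)
    moreover have "inj_on g {x \<in> B. f x = c}"
      by (rule inj_on_subset[OF assms(2)]) (use that in auto)
    ultimately show ?thesis by (simp add: card_image)
  qed
  then show ?thesis
    using assms(1,3) im unfolding zero_ULSE_colouring_def colouring_def by auto
qed

theorem theorem5p7: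
  fixes l :: nat
  assumes "0 < l"
    and "\<exists>(P :: 'a set) \<L>. affine_plane (l - 2) P \<L>"
  shows "\<exists>(V :: nat set) \<B>.
           bibd (l * (l - 2)\<^sup>2) ((l - 1) * (l - 2)) (l - 2) V \<B> \<and>
           (\<exists>(C :: nat set) f. zero_ULSE_colouring l ((l - 1) * (l - 2)) V \<B> C f)"
proof -
  obtain P :: "'a set" and R where "parallel_classes (l - 2) P R"
    using assms(2) affine_plane_parallel_classes by metis
  then interpret parallel_classes "l - 2" P R .
  \<comment> \<open>The order l - 2 is at least 2, so the truncated subtraction is exact.\<close>
  have l: "l - 2 + 2 = l" "l - 2 + 1 = l - 1" using order_ge_2 by auto
  obtain g :: "nat \<times> 'a \<Rightarrow> nat" where g: "inj_on g points"
    using finite_imp_inj_to_nat_seg[OF finite_design_points] by blast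
  have "B \<subseteq> points" if "B \<in># blocks" for B
    using bibd_blocks that by (auto simp: bibd_def)
  from zero_ULSE_colouring_image[OF zero_ULSE_colouring_fst g this] bibd_image[OF bibd_blocks g]
  show ?thesis unfolding l by blast
qed

end
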